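(* For $\zeta\in\Omega\subset\mathbb{C}-\{0\}$, the following identity holds: $$\frac{\operatorname{Im}\left(\zeta+\frac1\zeta\right)}{\operatorname{Im}\left(\zeta-\frac1\zeta\right)}=\frac1i\prod_{k=1}^{\infty}\left\{\left(\frac{(k-1)\pi+i\ln|\zeta|}{(k-\frac12)\pi+i\ln|\zeta|}\right)\left(\frac{k\pi-i\ln|\zeta|}{(k-\frac12)\pi-i\ln|\zeta|}\right)\right\}.$$
   Context: $\Omega$ is a subset of the complex plane with the origin removed; $\operatorname{Im}$ denotes the imaginary part and $\ln|\zeta|$ the real natural logarithm of $|\zeta|$. *)

theory Defs
  imports "HOL-Analysis.Analysis"
begin

(* The k-th factor of the infinite product, k >= 1; library products start at index 0, so the
   product over k >= 1 is written with ln_factor \<zeta> (Suc k). For |\<zeta>| = 1 the factor k = 1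
   vanishes; convergent_prod and prodinf admit finitely many zero factors.
   The quotient Im (\<zeta> + 1/\<zeta>) / Im (\<zeta> - 1/\<zeta>) is defined (not 0/0) exactly for non-real \<zeta>;
   this is stated as the hypothesis that its denominator is nonzero. *)
definition ln_factor :: "complex \<Rightarrow> nat \<Rightarrow> complex" where
  "ln_factor \<zeta> k =
     (((of_nat k - 1) * of_real pi + \<i> * of_real (ln (cmod \<zeta>))) /
      ((of_nat k - 1/2) * of_real pi + \<i> * of_real (ln (cmod \<zeta>)))) *
     ((of_nat k * of_real pi - \<i> * of_real (ln (cmod \<zeta>))) /
      ((of_nat k - 1/2) * of_real pi - \<i> * of_real (ln (cmod \<zeta>))))"

end

theory Submission
  imports Defs
begin

text \<open>
  With \<open>z = \<i> ln \<bar>\<zeta>\<bar> / \<pi>\<close> the \<open>k\<close>-th factor is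
  \<open>(k - 1 + z) (k - z) / ((k - 1/2 + z) (k - 1/2 - z))\<close>. In Euler's limit formula for the
  reciprocal Gamma function the normalising terms of the four progressions cancel, so the product is
  \<open>\<Gamma>(1/2 + z) \<Gamma>(1/2 - z) / (\<Gamma>(z) \<Gamma>(1 - z))\<close>, which equals
  \<open>sin (\<pi> z) / cos (\<pi> z) = \<i> tanh (ln \<bar>\<zeta>\<bar>)\<close> by the reflection formula. In polar
  coordinates the quotient of imaginary parts is \<open>tanh (ln \<bar>\<zeta>\<bar>)\<close> as well.
\<close>

text \<open>\<open>a\<close> and \<open>b\<close> are left unrestricted so that a vanishing factor
  is allowed; the limit is then 0.\<close>

lemma LIMSEQ_prod_rGamma:
  fixes a b c d :: complex
  assumes "a + b = c + d" and "c \<notin> \<int>\<^sub>\<le>\<^sub>0" and "d \<notin> \<int>\<^sub>\<le>\<^sub>0"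
  shows "(\<lambda>n. \<Prod>k\<le>n. ((a + of_nat k) * (b + of_nat k)) / ((c + of_nat k) * (d + of_nat k)))
           \<longlonglongrightarrow> (rGamma a * rGamma b) / (rGamma c * rGamma d)"
proof -
  have eq: "(rGamma_series a n * rGamma_series b n) / (rGamma_series c n * rGamma_series d n) =
      (\<Prod>k\<le>n. ((a + of_nat k) * (b + of_nat k)) / ((c + of_nat k) * (d + of_nat k)))" for n
  proof -
    \<comment> \<open>\<open>E x\<close> is the normalising term n! n^x of
      \<open>rGamma_series\<close>. Since x enters only through an exponential,
      \<open>E a * E b\<close> depends only on \<open>a + b\<close>.\<close>
    define E where "E = (\<lambda>x :: complex. fact n * exp (x * of_real (ln (of_nat n))) :: complex)"
    have E: "rGamma_series x n = (\<Prod>k\<le>n. x + of_nat k) / E x" for x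
      by (simp add: rGamma_series_def E_def pochhammer_prod atLeast0LessThan lessThan_Suc_atMost)
    have "exp ((a + b) * of_real (ln (of_nat n))) = exp ((c + d) * of_real (ln (of_nat n)))"
      by (simp only: assms(1))
    then have "E a * E b = E c * E d"
      by (simp add: E_def distrib_right exp_add)
    moreover have "E x \<noteq> 0" for x
      by (simp add: E_def)
    ultimately have "(A / E a * (B / E b)) / (C / E c * (D / E d)) = (A * B) / (C * D)" for A B C D
      by simp
    then show ?thesis
      unfolding E by (simp add: prod.distrib prod_dividef)
  qed
  have "(\<lambda>n. (rGamma_series a n * rGamma_series b n) / (rGamma_series c n * rGamma_series d n))
          \<longlonglongrightarrow> (rGamma a * rGamma b) / (rGamma c * rGamma d)"
    using assms(2,3) by (intro tendsto_intros rGamma_series_LIMSEQ) (auto simp: rGamma_eq_zero_iff)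
  then show ?thesis
    unfolding eq .
qed

text \<open>Partial products tending to 0 do not witness \<open>raw_has_prod\<close>. Keeping
  \<open>a\<close> and \<open>b\<close> away from the zeros of \<open>rGamma\<close> makes the limit
  nonzero.\<close>

lemma convergent_prod_rGamma:
  fixes a b c d :: complex
  assumes "a + b = c + d" and "a \<notin> \<int>\<^sub>\<le>\<^sub>0" "b \<notin> \<int>\<^sub>\<le>\<^sub>0" "c \<notin> \<int>\<^sub>\<le>\<^sub>0" "d \<notin> \<int>\<^sub>\<le>\<^sub>0"
  shows "convergent_prod (\<lambda>k. ((a + of_nat k) * (b + of_nat k)) / ((c + of_nat k) * (d + of_nat k)))"
proof -
  have nz: "(rGamma a * rGamma b) / (rGamma c * rGamma d) \<noteq> 0"
    using assms by (simp add: rGamma_eq_zero_iff)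
  have "raw_has_prod (\<lambda>k. ((a + of_nat k) * (b + of_nat k)) / ((c + of_nat k) * (d + of_nat k))) 0
      ((rGamma a * rGamma b) / (rGamma c * rGamma d))"
    unfolding raw_has_prod_def add_0_right using LIMSEQ_prod_rGamma[OF assms(1,4,5)] nz ..
  then show ?thesis
    unfolding convergent_prod_def by blast
qed

lemma sin_over_cos_rGamma:
  fixes z :: complex
  shows "(rGamma z * rGamma (1 - z)) / (rGamma (1/2 + z) * rGamma (1/2 - z)) =
           sin (of_real pi * z) / cos (of_real pi * z)"
proof -
  have "rGamma (1/2 + z) * rGamma (1/2 - z) = sin (of_real pi * (1/2 + z)) / of_real pi"
    using rGamma_reflection_complex[of "1/2 + z"] by (simp add: algebra_simps)
  also have "sin (of_real pi * (1/2 + z)) = cos (of_real pi * z)"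
    by (simp add: distrib_left sin_add flip: of_real_divide sin_of_real cos_of_real)
  finally show ?thesis
    by (simp add: rGamma_reflection_complex)
qed

lemma Im_add_inverse_over_Im_diff_inverse:
  assumes "Im (\<zeta> - 1 / \<zeta>) \<noteq> 0"
  shows "Im (\<zeta> + 1 / \<zeta>) / Im (\<zeta> - 1 / \<zeta>) = tanh (ln (cmod \<zeta>))"
proof -
  define r where "r = cmod \<zeta>"
  \<comment> \<open>For real \<zeta>, including 0 with \<open>1 / 0 = 0\<close>, the denominator
    would vanish.\<close>
  have "\<zeta> \<noteq> 0" and im: "Im \<zeta> \<noteq> 0"
    using assms by (auto simp: Im_divide)
  then have r: "r > 0"
    by (simp add: r_def)
  \<comment> \<open>As 1/\<zeta> is the conjugate of \<zeta> divided by \<open>r\<^sup>2\<close>,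
    both imaginary parts are real multiples of \<open>Im \<zeta>\<close>, which cancels.\<close>
  have inv: "Im (1 / \<zeta>) = - Im \<zeta> / r\<^sup>2"
    by (simp add: Im_divide r_def cmod_power2)
  have "Im (\<zeta> + 1 / \<zeta>) / Im (\<zeta> - 1 / \<zeta>) = (Im \<zeta> * (1 - 1 / r\<^sup>2)) / (Im \<zeta> * (1 + 1 / r\<^sup>2))"
    by (simp add: inv algebra_simps)
  also have "\<dots> = (1 - 1 / r\<^sup>2) / (1 + 1 / r\<^sup>2)"
    using im by simp
  also have "\<dots> = tanh (ln r)"
    using r by (simp add: tanh_ln_real divide_simps)
  finally show ?thesis
    by (simp add: r_def)
qed

theorem proposition6p2:
  fixes \<Omega> :: "complex set" and \<zeta> :: complex
  assumes "\<Omega> \<subseteq> UNIV - {0}"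
    and "\<zeta> \<in> \<Omega>"
    and "Im (\<zeta> - 1 / \<zeta>) \<noteq> 0"
  shows "convergent_prod (\<lambda>k. ln_factor \<zeta> (Suc k)) \<and>
         complex_of_real (Im (\<zeta> + 1 / \<zeta>) / Im (\<zeta> - 1 / \<zeta>)) =
           1 / \<i> * (\<Prod>k. ln_factor \<zeta> (Suc k))"
proof -
  define L where "L = ln (cmod \<zeta>)"
  define z where "z = \<i> * of_real (L / pi)"
  have piz: "of_real pi * z = \<i> * of_real L"
    by (simp add: z_def)
  \<comment> \<open>Since z is purely imaginary, shifting z or -z by a positive real stays clear of
    the zeros of \<open>rGamma\<close>.\<close>
  have nonpos: "x \<notin> \<int>\<^sub>\<le>\<^sub>0" if "Re x > 0" for x :: complex
    using that by (auto elim!: nonpos_Ints_cases)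
  have factor: "ln_factor \<zeta> (Suc k) =
      ((z + of_nat k) * (1 - z + of_nat k)) / ((1/2 + z + of_nat k) * (1/2 - z + of_nat k))" for k
  proof -
    have "ln_factor \<zeta> (Suc k) =
        ((of_real pi * (z + of_nat k)) / (of_real pi * (1/2 + z + of_nat k))) *
        ((of_real pi * (1 - z + of_nat k)) / (of_real pi * (1/2 - z + of_nat k)))"
      unfolding ln_factor_def L_def[symmetric] distrib_left right_diff_distrib piz
      by (simp add: algebra_simps)
    then show ?thesis
      by simp
  qed
  txt \<open>For \<open>\<bar>\<zeta>\<bar> = 1\<close> the first factor is zero, hence the shift.\<close>
  have "convergent_prod (\<lambda>k. ((1 + z + of_nat k) * (2 - z + of_nat k)) /
          ((3/2 + z + of_nat k) * (3/2 - z + of_nat k)))"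
    by (rule convergent_prod_rGamma) (auto intro!: nonpos simp: z_def)
  also have "(\<lambda>k. ((1 + z + of_nat k) * (2 - z + of_nat k)) /
          ((3/2 + z + of_nat k) * (3/2 - z + of_nat k))) = (\<lambda>k. ln_factor \<zeta> (Suc (k + 1)))"
    unfolding factor by (simp add: algebra_simps)
  finally have conv: "convergent_prod (\<lambda>k. ln_factor \<zeta> (Suc k))"
    by (subst (asm) convergent_prod_iff_shift)
  \<comment> \<open>The limit is taken without the shift: z = 0 is harmless here, as
    \<open>rGamma 0 = 0\<close> matches the zero factor.\<close>
  have "(\<lambda>n. \<Prod>k\<le>n. ln_factor \<zeta> (Suc k)) \<longlonglongrightarrow>
      (rGamma z * rGamma (1 - z)) / (rGamma (1/2 + z) * rGamma (1/2 - z))"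
    unfolding factor by (rule LIMSEQ_prod_rGamma) (auto intro!: nonpos simp: z_def)
  with convergent_prod_LIMSEQ[OF conv]
  have "(\<Prod>k. ln_factor \<zeta> (Suc k)) = sin (\<i> * of_real L) / cos (\<i> * of_real L)"
    by (metis LIMSEQ_unique sin_over_cos_rGamma piz)
  \<comment> \<open>This factor \<i> cancels the 1/\<i> in the claim.\<close>
  also have "\<dots> = \<i> * tanh (of_real L)"
    by (simp add: tanh_conv_tan tan_def)
  also have "tanh (of_real L) = complex_of_real (tanh L)"
    by (simp add: tanh_def sinh_def cosh_def scaleR_conv_of_real exp_of_real flip: of_real_minus)
  finally show ?thesis
    using conv Im_add_inverse_over_Im_diff_inverse[OF assms(3)] by (simp add: L_def)
qed

end
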